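(* Let $d\ge 1$ be an integer and let $\bar\alpha=\langle\alpha_1,\dots,\alpha_d\rangle$, $\bar\gamma=\langle\gamma_1,\dots,\gamma_d\rangle$, $\bar\beta=\langle\beta_1,\dots,\beta_d\rangle$, $\bar\delta=\langle\delta_1,\dots,\delta_d\rangle$ be vectors in $\mathbb{R}^d$. Suppose that for every integer $n\ge 1$, $$\sum_{i=1}^d \lfloor n\alpha_i+\gamma_i\rfloor=\sum_{i=1}^d \lfloor n\beta_i+\delta_i\rfloor .$$ Then either $\bar\alpha$ is rational, or there are lattice points $\bar\zeta=\langle\zeta_1,\dots,\zeta_d\rangle,\ \bar\eta=\langle\eta_1,\dots,\eta_d\rangle\in\mathbb{Z}^d$ and a permutation $\sigma$ of $\{1,2,\dots,d\}$ such that $\beta_i=\alpha_{\sigma(i)}+\zeta_i$ and $\delta_i=\gamma_{\sigma(i)}+\eta_i$ for all $1\le i\le d$, and $\sum_{i=1}^d\zeta_i=\sum_{i=1}^d\eta_i=0$.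
   Context: A vector $\bar\zeta\in\mathbb{R}^d$ is called rational if there is a nonzero vector of integers $\bar c\in\mathbb{Z}^d$ such that the dot product $\bar c\cdot\bar\zeta$ is an integer; otherwise $\bar\zeta$ is called irrational. *)

theory Defs
  imports "HOL-Analysis.Analysis"
begin

definition rational_vector :: "real ^ 'd \<Rightarrow> bool" where
  "rational_vector z \<longleftrightarrow>
     (\<exists>c :: int ^ 'd. c \<noteq> 0 \<and> (\<chi> i. real_of_int (c $ i)) \<bullet> z \<in> \<int>)"

end

theory Submission
  imports Defs
begin

text \<open>
  Write \<open>e(x)\<close> for \<open>exp (2 \<pi> \<i> x)\<close> and replace each floor by the centred fractional part, scaled
  so that its Fourier series is \<open>\<Sum>\<^bsub>k \<noteq> 0\<^esub> e(k x) / k\<close>; call this function the sawtooth. The two sums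
  of floors agree for all \<open>n\<close>, so the corresponding sums of sawtooth values differ by an affine
  function of \<open>n\<close>. It is bounded, hence constant (\<open>saw_coeff_sums_eq\<close>). Consequently both sums have
  the same mean value against \<open>e(- n \<theta>)\<close> for every irrational \<open>\<theta>\<close>.

  These mean values can be computed for each summand. The sequence with slope \<open>b\<close> and offset \<open>d\<close> has
  mean value \<open>e(k d) / k\<close> against \<open>e(- n \<theta>)\<close> if \<open>\<theta>\<close> is congruent to \<open>k b\<close> modulo \<open>1\<close>, and \<open>0\<close> if there is
  no such integer \<open>k\<close> (\<open>saw_coeff_resonant\<close>, \<open>saw_coeff_nonresonant\<close>). For the proof, the Fourier
  series is damped by \<open>r ^ \<bar>k\<bar>\<close>, which makes it absolutely convergent and expresses it by complex
  logarithms. As \<open>r\<close> tends to \<open>1\<close>, the damped function stays bounded and converges to the sawtooth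
  uniformly away from the integers, and for irrational \<open>b\<close> the points \<open>n b + d\<close> rarely come near an
  integer (\<open>rarely_near_Ints\<close>).

  If \<open>\<alpha>\<close> is irrational, then \<open>1\<close> and the components of \<open>\<alpha>\<close> are linearly independent over the rationals.
  At the frequency \<open>\<theta> = q \<alpha>\<^sub>i\<close> the left-hand side is then \<open>e(q \<gamma>\<^sub>i) / q\<close>, so some \<open>\<beta>\<^sub>j\<close> satisfies a
  congruence \<open>\<alpha>\<^sub>i \<equiv> k \<beta>\<^sub>j\<close>. Independence and counting make \<open>i \<mapsto> j\<close> a bijection, and so
  \<open>e(q \<gamma>\<^sub>i) = e(q k \<delta>\<^sub>j) / k\<close>. The cases \<open>q = 1\<close> and \<open>q = 2\<close> together give \<open>k\<^sup>2 = k\<close>, hence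
  \<open>k = 1\<close> and \<open>\<gamma>\<^sub>i \<equiv> \<delta>\<^sub>j\<close> (\<open>saw_coeff_determines\<close>). Inserting this matching into the hypothesis for
  \<open>n = 1\<close> and \<open>n = 2\<close> shows that the integer shifts sum to zero.
\<close>

section \<open>Mean values of sequences\<close>

definition has_mean :: "(nat \<Rightarrow> complex) \<Rightarrow> complex \<Rightarrow> bool" where
  "has_mean f l \<longleftrightarrow> (\<lambda>N. (\<Sum>n<N. f n) / of_nat N) \<longlonglongrightarrow> l"

lemma has_mean_unique: "has_mean f l \<Longrightarrow> has_mean f l' \<Longrightarrow> l = l'"
  unfolding has_mean_def by (rule LIMSEQ_unique)

lemma has_mean_add: "has_mean f a \<Longrightarrow> has_mean g b \<Longrightarrow> has_mean (\<lambda>n. f n + g n) (a + b)"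
  unfolding has_mean_def by (drule (1) tendsto_add) (simp add: sum.distrib add_divide_distrib)

lemma has_mean_cmult: "has_mean f a \<Longrightarrow> has_mean (\<lambda>n. c * f n) (c * a)"
  unfolding has_mean_def
  by (drule tendsto_mult_left[of _ _ _ c]) (simp add: sum_distrib_left)

lemma has_mean_diff: "has_mean f a \<Longrightarrow> has_mean g b \<Longrightarrow> has_mean (\<lambda>n. f n - g n) (a - b)"
  unfolding has_mean_def by (drule (1) tendsto_diff) (simp add: sum_subtractf diff_divide_distrib)

lemma has_mean_const: "has_mean (\<lambda>n. c) c"
  unfolding has_mean_def
proof (rule tendsto_eventually, rule eventually_sequentiallyI)
  fix N :: nat assume "N \<ge> 1"
  then show "(\<Sum>n<N. c) / of_nat N = c" by simp
qed

lemma has_mean_sum: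
  "(\<And>i. i \<in> A \<Longrightarrow> has_mean (f i) (l i)) \<Longrightarrow> has_mean (\<lambda>n. \<Sum>i\<in>A. f i n) (\<Sum>i\<in>A. l i)"
proof (induction A rule: infinite_finite_induct)
  case (insert x A)
  then show ?case by (simp add: has_mean_add)
qed (simp_all add: has_mean_const)

lemma sum_lessThan_add:
  fixes f :: "nat \<Rightarrow> 'a::comm_monoid_add"
  shows "(\<Sum>n<N + q. f n) = (\<Sum>n<N. f n) + (\<Sum>n<q. f (n + N))"
  by (induction q) (simp_all add: ac_simps)

text \<open>
  Shifting the index by \<open>q\<close> changes a partial sum only in its \<open>2 * q\<close> boundary terms but
  also multiplies it by \<open>w\<close>, so the partial sums stay bounded. The case \<open>q = 1\<close> is that of
  geometric sums; for general \<open>q\<close> it covers a periodic sequence times a character.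
\<close>
lemma has_mean_zero_if_quasiperiodic:
  fixes f :: "nat \<Rightarrow> complex"
  assumes shift: "\<And>n. f (n + q) = w * f n" and "w \<noteq> 1" and bound: "\<And>n. norm (f n) \<le> B"
  shows "has_mean f 0"
proof -
  define C where "C = 2 * real q * B / norm (w - 1)"
  have S: "norm (\<Sum>n<N. f n) \<le> C" for N
  proof -
    have "(\<Sum>n<N. f n) + (\<Sum>n<q. f (n + N)) = (\<Sum>n<q. f n) + (\<Sum>n<N. f (n + q))"
      using sum_lessThan_add[of f N q] sum_lessThan_add[of f q N] by (simp add: add.commute)
    moreover have "(\<Sum>n<N. f (n + q)) = w * (\<Sum>n<N. f n)"
      by (simp add: shift sum_distrib_left)
    ultimately have "(w - 1) * (\<Sum>n<N. f n) = (\<Sum>n<q. f (n + N)) - (\<Sum>n<q. f n)"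
      by (simp add: algebra_simps)
    then have "norm (w - 1) * norm (\<Sum>n<N. f n) = norm ((\<Sum>n<q. f (n + N)) - (\<Sum>n<q. f n))"
      by (metis norm_mult)
    also have "\<dots> \<le> norm (\<Sum>n<q. f (n + N)) + norm (\<Sum>n<q. f n)"
      by (rule norm_triangle_ineq4)
    also have "\<dots> \<le> real q * B + real q * B"
      using sum_norm_bound[of "{..<q}" "\<lambda>n. f (n + N)" B] sum_norm_bound[of "{..<q}" f B] bound
      by (intro add_mono) auto
    finally show ?thesis
      using \<open>w \<noteq> 1\<close> by (simp add: C_def field_simps)
  qed
  show ?thesis
    unfolding has_mean_def
  proof (rule Lim_null_comparison)
    show "\<forall>\<^sub>F N in sequentially. norm ((\<Sum>n<N. f n) / of_nat N) \<le> C / real N"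
      by (intro always_eventually allI) (simp add: norm_divide divide_right_mono S)
    show "(\<lambda>N. C / real N) \<longlonglongrightarrow> 0"
      by (rule lim_const_over_n)
  qed
qed

section \<open>Characters of the circle\<close>

definition circle :: "real \<Rightarrow> complex" where
  "circle x = cis (2 * pi * x)"

lemma norm_circle [simp]: "norm (circle x) = 1"
  by (simp add: circle_def)

lemma circle_nonzero [simp]: "circle x \<noteq> 0"
  by (simp add: circle_def)

lemma circle_add: "circle (x + y) = circle x * circle y"
  by (simp add: circle_def cis_mult ring_distribs)

lemma circle_minus: "circle (- x) = cnj (circle x)"
  by (simp add: circle_def cis_cnj)

lemma circle_power: "circle x ^ n = circle (real n * x)"
  unfolding circle_def Complex.DeMoivre[of "2 * pi * x"] by (simp only: mult.left_commute[of "real n" "2 * pi" x])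

lemma circle_eq_1_iff: "circle x = 1 \<longleftrightarrow> x \<in> \<int>"
proof
  assume "circle x = 1"
  then have "cos (2 * pi * x) = 1"
    by (simp add: circle_def complex_eq_iff)
  then obtain n :: int where "2 * pi * x = of_int n * (2 * pi)"
    by (auto simp: cos_one_2pi_int)
  then have "x = of_int n"
    by simp
  then show "x \<in> \<int>"
    by simp
qed (simp add: circle_def)

lemma circle_eq_iff: "circle x = circle y \<longleftrightarrow> x - y \<in> \<int>"
proof -
  have "circle x = circle (x - y) * circle y"
    by (simp flip: circle_add)
  then have "circle x = circle y \<longleftrightarrow> circle (x - y) = 1"
    by simp
  then show ?thesis
    by (simp add: circle_eq_1_iff)
qed

text \<open>
  The orthogonality relation that makes a mean value pick out a single frequency.
\<close>
lemma has_mean_circle: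
  "has_mean (\<lambda>n. circle (real n * x)) (if x \<in> \<int> then 1 else 0)"
proof (cases "x \<in> \<int>")
  case True
  then have "circle (real n * x) = 1" for n
    by (simp add: circle_eq_1_iff)
  with True show ?thesis
    by (simp add: has_mean_const)
next
  case False
  have "has_mean (\<lambda>n. circle (real n * x)) 0"
  proof (rule has_mean_zero_if_quasiperiodic[of _ 1 "circle x" 1])
    show "circle (real (n + 1) * x) = circle x * circle (real n * x)" for n
      by (simp add: algebra_simps flip: circle_add)
  qed (use False in \<open>auto simp: circle_eq_1_iff\<close>)
  with False show ?thesis
    by simp
qed

section \<open>The sawtooth and its Poisson smoothing\<close>

text \<open>
  The scaling makes the Fourier series of the sawtooth equal to
  \<open>\<Sum>\<^bsub>k \<noteq> 0\<^esub> circle (k x) / k\<close>. At integers the value \<open>\<pi> \<i>\<close> is that of the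
  right-hand limit, whereas the Fourier series converges to \<open>0\<close> there.
\<close>
definition saw :: "real \<Rightarrow> complex" where
  "saw x = 2 * pi * \<i> * of_real (1 / 2 - frac x)"

text \<open>
  The Abel means of that Fourier series: the terms with \<open>k\<close> and \<open>-k\<close> are damped by
  \<open>r ^ \<bar>k\<bar>\<close>, and the two halves are logarithmic series.
\<close>
definition smooth_saw :: "real \<Rightarrow> real \<Rightarrow> complex" where
  "smooth_saw r x = Ln (1 - r * circle (- x)) - Ln (1 - r * circle x)"

lemma norm_saw_le: "norm (saw x) \<le> pi"
proof -
  have "\<bar>1 / 2 - frac x\<bar> \<le> 1 / 2"
    using frac_ge_0[of x] frac_lt_1[of x] by linarith
  moreover have "norm (saw x) = 2 * pi * \<bar>1 / 2 - frac x\<bar>"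
    unfolding saw_def by (simp only: norm_mult norm_of_real) simp
  ultimately show ?thesis
    by simp
qed

lemma smooth_saw_frac: "smooth_saw r (frac x) = smooth_saw r x"
proof -
  have "circle (frac x) = circle x" "circle (- frac x) = circle (- x)"
    by (simp_all add: circle_eq_iff frac_def)
  then show ?thesis
    by (simp add: smooth_saw_def)
qed

lemma Re_one_minus_circle_pos:
  fixes r x :: real
  assumes "0 \<le> r" "r \<le> 1" "r < 1 \<or> x \<notin> \<int>"
  shows "Re (1 - r * circle x) > 0"
proof -
  have c: "Re (circle x) \<le> 1"
    by (simp add: circle_def)
  have "r * Re (circle x) < 1"
  proof (cases "r < 1")
    case True
    have "r * Re (circle x) \<le> r * 1"
      using c assms by (intro mult_left_mono) auto
    with True show ?thesis by simp
  next
    case False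
    with assms have "r = 1" "x \<notin> \<int>" by auto
    have "Re (circle x) \<noteq> 1"
    proof
      assume "Re (circle x) = 1"
      then obtain n :: int where "2 * pi * x = of_int n * (2 * pi)"
        by (auto simp: circle_def cos_one_2pi_int)
      then have "x = of_int n" by simp
      with \<open>x \<notin> \<int>\<close> show False by simp
    qed
    with c \<open>r = 1\<close> show ?thesis by simp
  qed
  then show ?thesis
    by simp
qed

text \<open>
  The two logarithms are complex conjugates, so their difference is twice an argument; and
  \<open>1 - r * circle x\<close> lies in the right half plane, where arguments stay between \<open>- \<pi> / 2\<close>
  and \<open>\<pi> / 2\<close>.
  Thus the smoothing does not overshoot at the jumps of the sawtooth, as partial sums of the
  Fourier series would.
\<close>
lemma norm_smooth_saw_le:
  assumes "0 \<le> r" "r < 1"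
  shows "norm (smooth_saw r x) \<le> pi"
proof -
  define z where "z = 1 - of_real r * circle x"
  have pos: "Re z > 0"
    unfolding z_def using assms by (intro Re_one_minus_circle_pos) auto
  have "1 - of_real r * circle (- x) = cnj z"
    by (simp add: z_def circle_minus)
  moreover have "Ln (cnj z) = cnj (Ln z)"
    using pos by (subst cnj_Ln) (auto simp: complex_nonpos_Reals_iff)
  ultimately have "smooth_saw r x = cnj (Ln z) - Ln z"
    unfolding smooth_saw_def by (simp only: z_def)
  also have "\<dots> = - (2 * \<i> * of_real (Im (Ln z)))"
    by (simp add: complex_eq_iff)
  finally have "smooth_saw r x = - (2 * \<i> * of_real (Im (Ln z)))" .
  then have "norm (smooth_saw r x) = 2 * \<bar>Im (Ln z)\<bar>"
    by (simp add: norm_mult)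
  also have "\<dots> \<le> pi"
    using Re_Ln_pos_lt_imp[OF pos] by simp
  finally show ?thesis .
qed

lemma smooth_saw_sums:
  assumes "0 \<le> r" "r < 1"
  shows "(\<lambda>k. r ^ k / of_nat k * (circle (real k * x) - circle (- (real k * x))))
           sums smooth_saw r x"
proof -
  have *: "(\<lambda>k. - ((r * circle y) ^ k / of_nat k)) sums Ln (1 - r * circle y)" for y
  proof -
    have "norm (- (complex_of_real r * circle y)) < 1"
      using assms by (simp add: norm_mult)
    from Ln_series'[OF this] show ?thesis
      by simp
  qed
  from sums_diff[OF *[of "- x"] *[of x]] show ?thesis
    unfolding smooth_saw_def
    by (simp add: power_mult_distrib circle_power diff_divide_distrib right_diff_distrib)
qed

text \<open>
  By the half-angle formulas \<open>1 - circle x\<close> has modulus \<open>2 sin (\<pi> x)\<close> and argument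
  \<open>\<pi> x - \<pi> / 2\<close>, so off the integers the logarithmic formula is exact at \<open>r = 1\<close>.
\<close>
lemma smooth_saw_1:
  assumes "0 < x" "x < 1"
  shows "smooth_saw 1 x = saw x"
proof -
  have x: "0 < pi * x" "pi * x < pi"
    using assms by simp_all
  then have s: "sin (pi * x) > 0"
    by (rule sin_gt_zero)
  have c: "cos (2 * pi * x) = 1 - 2 * sin (pi * x) ^ 2" "sin (2 * pi * x) = 2 * sin (pi * x) * cos (pi * x)"
    using cos_double_sin[of "pi * x"] sin_double[of "pi * x"] by (simp_all add: mult_ac)
  have "1 - circle x = rcis (2 * sin (pi * x)) (pi * x - pi / 2)"
    unfolding circle_def
    by (simp add: complex_eq_iff c cos_diff sin_diff power2_eq_square)
  moreover have "1 - circle (- x) = rcis (2 * sin (pi * x)) (pi / 2 - pi * x)"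
    unfolding circle_def
    by (simp add: complex_eq_iff c cos_diff sin_diff power2_eq_square)
  moreover have "pi * x - pi / 2 \<in> {-pi<..pi}" "pi / 2 - pi * x \<in> {-pi<..pi}"
  proof -
    show "pi * x - pi / 2 \<in> {-pi<..pi}" "pi / 2 - pi * x \<in> {-pi<..pi}"
      using x unfolding greaterThanAtMost_iff by linarith+
  qed
  ultimately have "smooth_saw 1 x = of_real (pi / 2 - pi * x) * \<i> - of_real (pi * x - pi / 2) * \<i>"
    using s unfolding smooth_saw_def by (simp add: Ln_rcis del: greaterThanAtMost_iff) (simp add: complex_eq_iff)
  also have "\<dots> = saw x"
  proof -
    have "frac x = x"
      using assms by (simp add: frac_eq)
    then show ?thesis
      by (simp add: saw_def complex_eq_iff right_diff_distrib)
  qed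
  finally show ?thesis .
qed

text \<open>
  Away from the integers the smoothing is jointly continuous in \<open>r\<close> and \<open>x\<close> up to \<open>r = 1\<close>;
  by periodicity \<open>x\<close> may be taken from a compact interval, which gives uniformity.
\<close>
lemma smooth_saw_uniform_limit:
  assumes "\<eta> > 0" "\<epsilon> > 0"
  shows "\<forall>\<^sub>F r in at_left 1. \<forall>x. (\<forall>p::int. \<eta> \<le> \<bar>x - of_int p\<bar>) \<longrightarrow> norm (smooth_saw r x - saw x) < \<epsilon>"
proof -
  define K where "K = {0..1::real} \<times> {\<eta>..1 - \<eta>}"
  have K: "fst z \<ge> 0" "fst z \<le> 1" "snd z \<notin> \<int>" "- snd z \<notin> \<int>" if "z \<in> K" for z
  proof -
    show "fst z \<ge> 0" "fst z \<le> 1"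
      using that by (auto simp: K_def)
    have "snd z > 0" "snd z < 1"
      using that assms by (auto simp: K_def)
    then have "frac (snd z) \<noteq> 0"
      by (simp add: frac_eq[THEN iffD2])
    then show "snd z \<notin> \<int>" "- snd z \<notin> \<int>"
      by (simp_all add: minus_in_Ints_iff)
  qed
  have "continuous_on K (\<lambda>z. smooth_saw (fst z) (snd z))"
    unfolding smooth_saw_def circle_def
  proof (intro continuous_intros)
    fix z assume z: "z \<in> K"
    note pos = Re_one_minus_circle_pos[of "fst z"]
    show "1 - complex_of_real (fst z) * cis (2 * pi * - snd z) \<notin> \<real>\<^sub>\<le>\<^sub>0"
      using pos[of "- snd z"] K[OF z] by (auto simp: circle_def complex_nonpos_Reals_iff)
    show "1 - complex_of_real (fst z) * cis (2 * pi * snd z) \<notin> \<real>\<^sub>\<le>\<^sub>0"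
      using pos[of "snd z"] K[OF z] by (auto simp: circle_def complex_nonpos_Reals_iff)
  qed
  then have "uniformly_continuous_on K (\<lambda>z. smooth_saw (fst z) (snd z))"
    by (rule compact_uniformly_continuous) (auto simp: K_def intro: compact_Times)
  then obtain d where d: "d > 0" "\<And>z z'. z \<in> K \<Longrightarrow> z' \<in> K \<Longrightarrow> dist z' z < d \<Longrightarrow>
      dist (smooth_saw (fst z') (snd z')) (smooth_saw (fst z) (snd z)) < \<epsilon>"
    using \<open>\<epsilon> > 0\<close> unfolding uniformly_continuous_on_def by metis
  have "\<forall>\<^sub>F r in at_left (1::real). r \<in> {max 0 (1 - d)<..<1}"
    using d by (intro eventually_at_left_real) auto
  then show ?thesis
  proof eventually_elim
    case (elim r)
    show ?case
    proof (intro allI impI)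
      fix x :: real assume far: "\<forall>p::int. \<eta> \<le> \<bar>x - of_int p\<bar>"
      have f: "\<eta> \<le> frac x" "frac x \<le> 1 - \<eta>"
        using far[rule_format, of "\<lfloor>x\<rfloor>"] far[rule_format, of "\<lfloor>x\<rfloor> + 1"]
          frac_ge_0[of x] frac_lt_1[of x] by (auto simp: frac_def)
      have "dist (r, frac x) (1, frac x) < d"
        using elim by (auto simp: dist_Pair_Pair dist_real_def)
      then have "norm (smooth_saw r (frac x) - smooth_saw 1 (frac x)) < \<epsilon>"
        using d(2)[of "(1, frac x)" "(r, frac x)"] elim f by (auto simp: K_def dist_norm)
      moreover have "smooth_saw 1 (frac x) = saw x"
        using smooth_saw_1[of "frac x"] f assms by (simp add: saw_def del: frac_gt_0_iff)
      ultimately show "norm (smooth_saw r x - saw x) < \<epsilon>"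
        by (simp add: smooth_saw_frac)
    qed
  qed
qed

section \<open>Irrational rotations rarely come close to an integer\<close>

lemma dist_from_Ints_pos:
  fixes x :: real
  assumes "x \<notin> \<int>"
  obtains m where "m > 0" "\<And>p::int. m \<le> \<bar>x - of_int p\<bar>"
proof
  show "min (frac x) (1 - frac x) > 0"
    using assms frac_lt_1[of x] by simp
  show "min (frac x) (1 - frac x) \<le> \<bar>x - of_int p\<bar>" for p :: int
  proof (cases "p \<le> \<lfloor>x\<rfloor>")
    case True
    then have "real_of_int p \<le> of_int \<lfloor>x\<rfloor>" by simp
    then show ?thesis unfolding frac_def by linarith
  next
    case False
    then have "real_of_int p \<ge> of_int \<lfloor>x\<rfloor> + 1" by linarith
    then show ?thesis unfolding frac_def by linarith
  qed
qed

text \<open>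
  No nonzero multiple of \<open>b\<close> is an integer, and finitely many positive distances have a positive
  lower bound.
\<close>
lemma dist_multiples_from_Ints_pos:
  fixes b :: real
  assumes "b \<notin> \<rat>"
  shows "\<exists>m>0. \<forall>k\<in>{1..K::nat}. \<forall>p::int. m \<le> \<bar>real k * b - of_int p\<bar>"
proof (induction K)
  case 0
  then show ?case by (intro exI[of _ 1]) auto
next
  case (Suc K)
  then obtain m where m: "m > 0" "\<forall>k\<in>{1..K::nat}. \<forall>p::int. m \<le> \<bar>real k * b - of_int p\<bar>"
    by blast
  have "real (Suc K) * b \<notin> \<int>"
  proof
    assume "real (Suc K) * b \<in> \<int>"
    then have "real (Suc K) * b / real (Suc K) \<in> \<rat>"
      by (intro Rats_divide) (auto simp: Ints_subset_Rats[THEN subsetD])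
    with assms show False by (simp del: of_nat_Suc)
  qed
  then obtain m' where m': "m' > 0" "\<And>p::int. m' \<le> \<bar>real (Suc K) * b - of_int p\<bar>"
    using dist_from_Ints_pos by blast
  have "min m m' \<le> \<bar>real k * b - of_int p\<bar>" if "k \<in> {1..Suc K}" for k and p :: int
  proof (cases "k = Suc K")
    case True
    with m'(2)[of p] show ?thesis by (simp add: min_le_iff_disj)
  next
    case False
    with that have "k \<in> {1..K}" by auto
    with m(2) have "m \<le> \<bar>real k * b - of_int p\<bar>" by blast
    then show ?thesis by (simp add: min_le_iff_disj)
  qed
  with m(1) m'(1) show ?case
    by (intro exI[of _ "min m m'"]) auto
qed

text \<open>
  Every block of \<open>K\<close> consecutive numbers contains at most one element of \<open>A\<close>.
\<close>
lemma card_separated_le: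
  fixes A :: "nat set"
  assumes "K \<ge> 1" and sep: "\<And>m n. m \<in> A \<Longrightarrow> n \<in> A \<Longrightarrow> m < n \<Longrightarrow> n \<ge> m + K"
  shows "card (A \<inter> {..<N}) \<le> N div K + 1"
proof -
  have *: "card (A \<inter> {..<q * K}) \<le> q" for q
  proof (induction q)
    case (Suc q)
    have "\<forall>m\<in>A \<inter> {q * K..<q * K + K}. \<forall>n\<in>A \<inter> {q * K..<q * K + K}. m = n"
    proof (intro ballI)
      fix m n assume "m \<in> A \<inter> {q * K..<q * K + K}" "n \<in> A \<inter> {q * K..<q * K + K}"
      then show "m = n"
        using sep[of m n] sep[of n m] by (cases m n rule: linorder_cases) auto
    qed
    then have "card (A \<inter> {q * K..<q * K + K}) \<le> 1"
      by (simp add: card_le_Suc0_iff_eq)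
    moreover have "A \<inter> {..<Suc q * K} = (A \<inter> {..<q * K}) \<union> (A \<inter> {q * K..<q * K + K})"
      by auto
    ultimately show ?case
      using Suc card_Un_le[of "A \<inter> {..<q * K}" "A \<inter> {q * K..<q * K + K}"] by simp
  qed simp
  have "N \<le> (N div K + 1) * K"
    using \<open>K \<ge> 1\<close> dividend_less_div_times[of K N] by simp
  then have "A \<inter> {..<N} \<subseteq> A \<inter> {..<(N div K + 1) * K}"
    by auto
  then have "card (A \<inter> {..<N}) \<le> card (A \<inter> {..<(N div K + 1) * K})"
    by (intro card_mono) auto
  with *[of "N div K + 1"] show ?thesis
    by linarith
qed

text \<open>
  If \<open>n b + d\<close> is close to an integer for two indices \<open>n\<close>, then \<open>b\<close> times the difference of
  these indices is close to an integer, so the indices are far apart. This replaces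
  the equidistribution theorem: all that is needed is that the jumps of the sawtooth are rarely approached.
\<close>
lemma rarely_near_Ints:
  fixes b d :: real
  assumes "b \<notin> \<rat>" "\<epsilon> > 0"
  shows "\<exists>\<eta>>0. \<forall>\<^sub>F N in sequentially.
           real (card {n\<in>{..<N}. \<exists>p::int. \<bar>real n * b + d - of_int p\<bar> < \<eta>}) \<le> \<epsilon> * real N"
proof -
  obtain K :: nat where K: "K \<ge> 1" "1 / real K < \<epsilon> / 2"
    using \<open>\<epsilon> > 0\<close> by (metis One_nat_def Suc_leI half_gt_zero nat_approx_posE zero_less_Suc)
  obtain m where m: "m > 0" "\<forall>k\<in>{1..K}. \<forall>p::int. m \<le> \<bar>real k * b - of_int p\<bar>"
    using dist_multiples_from_Ints_pos[OF assms(1)] by blast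
  define A where "A = {n. \<exists>p::int. \<bar>real n * b + d - of_int p\<bar> < m / 2}"
  have sep: "n' \<ge> n + K" if n: "n \<in> A" "n' \<in> A" "n < n'" for n n'
  proof (rule ccontr)
    assume "\<not> n' \<ge> n + K"
    with n have k: "n' - n \<in> {1..K}" by auto
    obtain p p' :: int where
      "\<bar>real n * b + d - of_int p\<bar> < m / 2" "\<bar>real n' * b + d - of_int p'\<bar> < m / 2"
      using n unfolding A_def by blast
    then have "\<bar>(real n' * b + d - of_int p') - (real n * b + d - of_int p)\<bar> < m"
      using abs_triangle_ineq4[of "real n' * b + d - of_int p'" "real n * b + d - of_int p"] by linarith
    moreover have "(real n' * b + d - of_int p') - (real n * b + d - of_int p)
        = real (n' - n) * b - of_int (p' - p)"
      using n by (simp add: of_nat_diff left_diff_distrib)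
    ultimately have "\<bar>real (n' - n) * b - of_int (p' - p)\<bar> < m"
      by (simp only:)
    with m(2) k show False
      by (meson not_le)
  qed
  have "\<forall>\<^sub>F N in sequentially. real (card {n\<in>{..<N}. \<exists>p::int. \<bar>real n * b + d - of_int p\<bar> < m / 2}) \<le> \<epsilon> * real N"
    using eventually_ge_at_top[of "nat \<lceil>2 / \<epsilon>\<rceil>"]
  proof eventually_elim
    case (elim N)
    then have "2 / \<epsilon> \<le> real N" by linarith
    then have N: "1 \<le> \<epsilon> / 2 * real N"
      using \<open>\<epsilon> > 0\<close> by (simp add: field_simps)
    have "{n\<in>{..<N}. \<exists>p::int. \<bar>real n * b + d - of_int p\<bar> < m / 2} = A \<inter> {..<N}"
      by (auto simp: A_def)
    then have "real (card {n\<in>{..<N}. \<exists>p::int. \<bar>real n * b + d - of_int p\<bar> < m / 2}) \<le> real (N div K + 1)"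
      using card_separated_le[OF K(1) sep, where N = N] by (simp only: of_nat_le_iff)
    also have "\<dots> \<le> real N / real K + 1"
      using of_nat_div_le_of_nat[of N K, where ?'a = real] by simp
    also have "real N / real K \<le> \<epsilon> / 2 * real N"
      using mult_right_mono[OF less_imp_le[OF K(2)], of "real N"] by simp
    finally show ?case
      using N by linarith
  qed
  with m(1) show ?thesis
    by (intro exI[of _ "m / 2"]) auto
qed

section \<open>Fourier coefficients of sawtooth sequences\<close>

text \<open>
  The smoothing differs from the sawtooth by little away from the integers, and by at most
  \<open>2 \<pi>\<close> on the rare visits near them. Hence it is close in mean, and mean values pass to the
  limit \<open>r \<rightarrow> 1\<close>.
\<close>
lemma has_mean_saw_of_smooth:
  assumes b: "b \<notin> \<rat>"
    and means: "\<And>r. 0 < r \<Longrightarrow> r < 1 \<Longrightarrow> has_mean (\<lambda>n. smooth_saw r (real n * b + d) * circle (- (real n * \<theta>))) (L r)"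
    and lim: "(L \<longlongrightarrow> l) (at_left 1)"
  shows "has_mean (\<lambda>n. saw (real n * b + d) * circle (- (real n * \<theta>))) l"
  unfolding has_mean_def
proof (rule tendstoI)
  fix \<epsilon> :: real assume "\<epsilon> > 0"
  define x where "x n = real n * b + d" for n :: nat
  define c where "c n = circle (- (real n * \<theta>))" for n :: nat
  \<comment> \<open>The bad indices contribute at most \<open>2 \<pi>\<close> each, hence \<open>\<epsilon> / 4\<close> in mean.\<close>
  have "\<epsilon> / (8 * pi) > 0"
    using \<open>\<epsilon> > 0\<close> by simp
  from rarely_near_Ints[OF b this, of d] obtain \<eta> where \<eta>: "\<eta> > 0"
    and rare: "\<forall>\<^sub>F N in sequentially.
      real (card {n\<in>{..<N}. \<exists>p::int. \<bar>x n - of_int p\<bar> < \<eta>}) \<le> \<epsilon> / (8 * pi) * real N"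
    unfolding x_def by blast
  have "\<forall>\<^sub>F r in at_left 1. r \<in> {0<..<1::real} \<and> dist (L r) l < \<epsilon> / 4 \<and>
      (\<forall>x. (\<forall>p::int. \<eta> \<le> \<bar>x - of_int p\<bar>) \<longrightarrow> norm (smooth_saw r x - saw x) < \<epsilon> / 4)"
    using \<open>\<epsilon> > 0\<close> \<eta>
    by (intro eventually_conj tendstoD[OF lim] smooth_saw_uniform_limit eventually_at_left_real) auto
  then obtain r where r': "r \<in> {0<..<1}" "dist (L r) l < \<epsilon> / 4"
    and good: "\<forall>x. (\<forall>p::int. \<eta> \<le> \<bar>x - of_int p\<bar>) \<longrightarrow> norm (smooth_saw r x - saw x) < \<epsilon> / 4"
    using eventually_happens[of _ "at_left (1::real)"] trivial_limit_at_left_real[of "1::real"] by blast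
  from r' have r: "0 < r" "r < 1" "dist (L r) l < \<epsilon> / 4"
    by auto
  have "\<forall>\<^sub>F N in sequentially. dist ((\<Sum>n<N. smooth_saw r (x n) * c n) / of_nat N) (L r) < \<epsilon> / 4"
    using means[OF r(1,2)] \<open>\<epsilon> > 0\<close> unfolding has_mean_def x_def c_def by (intro tendstoD) auto
  with rare show "\<forall>\<^sub>F N in sequentially.
      dist ((\<Sum>n<N. saw (real n * b + d) * circle (- (real n * \<theta>))) / of_nat N) l < \<epsilon>"
    using eventually_gt_at_top[of 0]
  proof eventually_elim
    case (elim N)
    define Bad where "Bad = {n\<in>{..<N}. \<exists>p::int. \<bar>x n - of_int p\<bar> < \<eta>}"
    have "norm (saw (x n) * c n - smooth_saw r (x n) * c n) \<le> \<epsilon> / 4 + (if n \<in> Bad then 2 * pi else 0)"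
      if "n < N" for n
    proof -
      have eq: "norm (saw (x n) * c n - smooth_saw r (x n) * c n) = norm (smooth_saw r (x n) - saw (x n))"
        by (simp add: c_def norm_mult norm_minus_commute flip: left_diff_distrib)
      show ?thesis
      proof (cases "n \<in> Bad")
        case True
        have "norm (smooth_saw r (x n) - saw (x n)) \<le> pi + pi"
          using norm_smooth_saw_le[of r "x n"] norm_saw_le[of "x n"] r
          by (intro norm_triangle_le_diff) auto
        with True eq \<open>\<epsilon> > 0\<close> show ?thesis by simp
      next
        case False
        with that good have "norm (smooth_saw r (x n) - saw (x n)) < \<epsilon> / 4"
          by (force simp: Bad_def not_less)
        with False eq show ?thesis by simp
      qed
    qed
    then have "norm (\<Sum>n<N. saw (x n) * c n - smooth_saw r (x n) * c n)
        \<le> (\<Sum>n<N. \<epsilon> / 4 + (if n \<in> Bad then 2 * pi else 0))"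
      by (intro sum_norm_le) auto
    also have "\<dots> = real N * (\<epsilon> / 4) + 2 * pi * real (card Bad)"
    proof -
      have "{..<N} \<inter> Bad = Bad" by (auto simp: Bad_def)
      then have "(\<Sum>n<N. if n \<in> Bad then 2 * pi else 0) = (\<Sum>n\<in>Bad. 2 * pi)"
        using sum.inter_restrict[of "{..<N}" "\<lambda>n. 2 * pi" Bad] by simp
      then show ?thesis
        by (simp add: sum.distrib)
    qed
    also have "\<dots> \<le> real N * (\<epsilon> / 4) + 2 * pi * (\<epsilon> / (8 * pi) * real N)"
      using elim by (intro add_left_mono mult_left_mono) (auto simp: Bad_def)
    also have "\<dots> = \<epsilon> / 2 * real N"
      by (simp add: field_simps)
    finally have "norm ((\<Sum>n<N. saw (x n) * c n) / of_nat N - (\<Sum>n<N. smooth_saw r (x n) * c n) / of_nat N)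
        \<le> \<epsilon> / 2"
      using elim by (simp add: norm_divide sum_subtractf field_simps flip: diff_divide_distrib)
    moreover have "dist ((\<Sum>n<N. smooth_saw r (x n) * c n) / of_nat N) (L r) < \<epsilon> / 4"
      using elim by simp
    ultimately have "dist ((\<Sum>n<N. saw (x n) * c n) / of_nat N) l < \<epsilon>"
      using r(3) by (simp only: dist_norm[symmetric]) metric
    then show ?case
      by (simp add: x_def c_def)
  qed
qed

text \<open>
  The absolutely convergent series may be averaged term by term, by Tannery's theorem, and each
  term is a character of \<open>n\<close>.
\<close>
lemma has_mean_smooth_saw:
  assumes r: "0 < r" "r < 1"
  shows "has_mean (\<lambda>n. smooth_saw r (real n * b + d) * circle (- (real n * \<theta>)))
    (\<Sum>k. of_real r ^ k / of_nat k *
       ((if real k * b - \<theta> \<in> \<int> then circle (real k * d) else 0)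
        - (if - (real k * b) - \<theta> \<in> \<int> then circle (- (real k * d)) else 0)))"
proof -
  define g where "g k n = of_real r ^ k / of_nat k *
       (circle (real k * d) * circle (real n * (real k * b - \<theta>))
        - circle (- (real k * d)) * circle (real n * (- (real k * b) - \<theta>)))" for k n
  define a where "a k N = (\<Sum>n<N. g k n) / of_nat N" for k N
  define l where "l k = of_real r ^ k / of_nat k *
       ((if real k * b - \<theta> \<in> \<int> then circle (real k * d) else 0)
        - (if - (real k * b) - \<theta> \<in> \<int> then circle (- (real k * d)) else 0))" for k
  have g_sums: "(\<lambda>k. g k n) sums (smooth_saw r (real n * b + d) * circle (- (real n * \<theta>)))" for n
  proof -
    have "circle (real k * d) * circle (real n * (real k * b - \<theta>))
          = circle (real k * (real n * b + d)) * circle (- (real n * \<theta>))"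
        "circle (- (real k * d)) * circle (real n * (- (real k * b) - \<theta>))
          = circle (- (real k * (real n * b + d))) * circle (- (real n * \<theta>))" for k
      unfolding circle_add[symmetric] by (rule arg_cong[of _ _ circle], simp add: algebra_simps)+
    then have "g k n = of_real r ^ k / of_nat k * (circle (real k * (real n * b + d)) - circle (- (real k * (real n * b + d))))
        * circle (- (real n * \<theta>))" for k
      by (simp add: g_def left_diff_distrib mult.assoc)
    with sums_mult2[OF smooth_saw_sums] r show ?thesis
      by simp
  qed
  have "has_mean (g k) (l k)" for k
  proof -
    have "l k = of_real r ^ k / of_nat k *
       (circle (real k * d) * (if real k * b - \<theta> \<in> \<int> then 1 else 0)
        - circle (- (real k * d)) * (if - (real k * b) - \<theta> \<in> \<int> then 1 else 0))"
      by (simp add: l_def)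
    then show ?thesis
      unfolding g_def by (auto simp only: intro!: has_mean_cmult has_mean_diff has_mean_circle)
  qed
  then have lim: "a k \<longlonglongrightarrow> l k" for k
    by (simp add: has_mean_def a_def[abs_def])
  have g_bound: "norm (g k n) \<le> 2 * r ^ k" for k n
  proof -
    have "norm (circle (real k * d) * circle (real n * (real k * b - \<theta>))
        - circle (- (real k * d)) * circle (real n * (- (real k * b) - \<theta>))) \<le> 1 + 1"
      by (intro norm_triangle_le_diff) (simp add: norm_mult)
    moreover have "norm (complex_of_real r ^ k / of_nat k) \<le> r ^ k"
      using r by (cases "k = 0") (auto simp: norm_divide norm_power field_simps)
    ultimately have "norm (g k n) \<le> r ^ k * 2"
      unfolding g_def norm_mult[of "_ / _"] using r by (intro mult_mono) auto
    then show ?thesis by simp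
  qed
  have a_bound: "norm (a k N) \<le> 2 * r ^ k" for k N
  proof (cases "N = 0")
    case False
    have "norm (\<Sum>n<N. g k n) \<le> of_nat (card {..<N}) * (2 * r ^ k)"
      by (intro sum_norm_bound g_bound)
    with False show ?thesis
      by (simp add: a_def norm_divide field_simps)
  qed (use r in \<open>simp add: a_def\<close>)
  have "(\<lambda>N. \<Sum>k. a k N) \<longlonglongrightarrow> suminf l"
    using lim a_bound r
    by (intro tannerys_theorem[of a l sequentially "\<lambda>k. 2 * r ^ k", THEN conjunct2, THEN conjunct2])
       (auto intro!: summable_mult always_eventually summable_geometric)
  moreover have "(\<Sum>k. a k N) = (\<Sum>n<N. smooth_saw r (real n * b + d) * circle (- (real n * \<theta>))) / of_nat N" for N
    unfolding a_def by (intro sums_unique[symmetric] sums_divide sums_sum g_sums)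
  ultimately show ?thesis
    by (simp only: has_mean_def l_def[abs_def])
qed

text \<open>
  The frequencies in the series are the multiples of \<open>b\<close>, so without a resonance all its mean
  values vanish, for every \<open>r\<close>.
\<close>
lemma has_mean_saw_nonresonant:
  assumes "b \<notin> \<rat>" and nonres: "\<And>k::int. \<theta> - of_int k * b \<notin> \<int>"
  shows "has_mean (\<lambda>n. saw (real n * b + d) * circle (- (real n * \<theta>))) 0"
proof (rule has_mean_saw_of_smooth[OF assms(1)])
  fix r :: real assume r: "0 < r" "r < 1"
  have "of_int k * b - \<theta> \<notin> \<int>" for k :: int
    using nonres[of k] minus_in_Ints_iff[of "\<theta> - of_int k * b"] by simp
  from this[of "int k" for k] this[of "- int k" for k]
  have "real k * b - \<theta> \<notin> \<int>" "- (real k * b) - \<theta> \<notin> \<int>" for k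
    by simp_all
  with has_mean_smooth_saw[OF r, of b d \<theta>]
  show "has_mean (\<lambda>n. smooth_saw r (real n * b + d) * circle (- (real n * \<theta>))) 0"
    by simp
qed simp

lemma irrational_multiple_in_Ints:
  assumes "b \<notin> \<rat>" "of_int k * b \<in> \<int>"
  shows "k = 0"
proof (rule ccontr)
  assume "k \<noteq> 0"
  have "of_int k * b / of_int k \<in> \<rat>"
    using assms(2) by (intro Rats_divide) (auto simp: Ints_subset_Rats[THEN subsetD])
  with \<open>k \<noteq> 0\<close> assms(1) show False by simp
qed

text \<open>
  Since \<open>b\<close> is irrational, \<open>k\<close> is the only multiplier that yields the frequency \<open>\<theta>\<close>, so
  the series of mean values reduces to a single term.
\<close>
lemma has_mean_saw_resonant:
  fixes k :: int
  assumes b: "b \<notin> \<rat>" and "k \<noteq> 0" and res: "\<theta> - of_int k * b \<in> \<int>"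
  shows "has_mean (\<lambda>n. saw (real n * b + d) * circle (- (real n * \<theta>))) (circle (of_int k * d) / of_int k)"
proof (rule has_mean_saw_of_smooth[OF b])
  define m where "m = nat \<bar>k\<bar>"
  have m: "m > 0" "int m = \<bar>k\<bar>"
    using \<open>k \<noteq> 0\<close> by (auto simp: m_def)
  have only: "of_int j * b - \<theta> \<in> \<int> \<longleftrightarrow> j = k" for j :: int
  proof
    assume "of_int j * b - \<theta> \<in> \<int>"
    then have "(of_int j * b - \<theta>) + (\<theta> - of_int k * b) \<in> \<int>"
      using res by (rule Ints_add)
    then have "of_int (j - k) * b \<in> \<int>"
      by (simp add: algebra_simps)
    then show "j = k"
      using irrational_multiple_in_Ints[OF b] by fastforce
  next
    assume "j = k"
    then show "of_int j * b - \<theta> \<in> \<int>"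
      using res minus_in_Ints_iff[of "\<theta> - of_int k * b"] by simp
  qed
  fix r :: real assume r: "0 < r" "r < 1"
  define l where "l j = of_real r ^ j / of_nat j *
       ((if real j * b - \<theta> \<in> \<int> then circle (real j * d) else 0)
        - (if - (real j * b) - \<theta> \<in> \<int> then circle (- (real j * d)) else 0))" for j
  have l: "l j = of_real r ^ j / of_nat j *
       ((if int j = k then circle (real j * d) else 0)
        - (if - int j = k then circle (- (real j * d)) else 0))" for j
    using only[of "int j"] only[of "- int j"] by (simp add: l_def)
  have "suminf l = (\<Sum>j\<in>{m}. l j)"
  proof (rule suminf_finite)
    fix j assume "j \<notin> {m}"
    then have "int j \<noteq> k" "- int j \<noteq> k" using m by auto
    then show "l j = 0" by (simp add: l)
  qed simp
  also have "\<dots> = of_real r ^ m * (circle (of_int k * d) / of_int k)"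
  proof (cases "k > 0")
    case True
    then have "int m = k" "- int m \<noteq> k" "real m = of_int k" "complex_of_nat m = of_int k"
      using m(2) by auto
    then show ?thesis by (simp add: l)
  next
    case False
    then have "- int m = k" "int m \<noteq> k" using m \<open>k \<noteq> 0\<close> by auto
    moreover from this have "real_of_int k = - real m" "(of_int k :: complex) = - of_nat m"
      by auto
    ultimately show ?thesis by (simp add: l)
  qed
  finally show "has_mean (\<lambda>n. smooth_saw r (real n * b + d) * circle (- (real n * \<theta>)))
      (of_real r ^ nat \<bar>k\<bar> * (circle (of_int k * d) / of_int k))"
    using has_mean_smooth_saw[OF r, of b d \<theta>] by (simp add: l_def[abs_def] m_def)
next
  have "((\<lambda>r. of_real r ^ nat \<bar>k\<bar> * (circle (of_int k * d) / of_int k)) \<longlongrightarrow>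
      of_real 1 ^ nat \<bar>k\<bar> * (circle (of_int k * d) / of_int k)) (at_left (1::real))"
    by (intro tendsto_intros)
  then show "((\<lambda>r. of_real r ^ nat \<bar>k\<bar> * (circle (of_int k * d) / of_int k)) \<longlongrightarrow>
      circle (of_int k * d) / of_int k) (at_left (1::real))"
    by simp
qed

text \<open>
  For rational \<open>b\<close> the sequence can return to an integer periodically, so smoothing is of no use;
  but the sequence is periodic and has only rational frequencies.
\<close>
lemma has_mean_saw_rational:
  assumes b: "b \<in> \<rat>" and \<theta>: "\<theta> \<notin> \<rat>"
  shows "has_mean (\<lambda>n. saw (real n * b + d) * circle (- (real n * \<theta>))) 0"
proof -
  obtain p q :: int where q: "q > 0" and b_eq: "b = of_int p / of_int q"
    using b by (metis Rats_cases')
  define Q where "Q = nat q"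
  have Qb: "real Q * b = of_int p"
    using q by (simp add: Q_def b_eq)
  show ?thesis
  proof (rule has_mean_zero_if_quasiperiodic[of _ Q "circle (- (real Q * \<theta>))" pi])
    fix n
    have eq: "real (n + Q) * b + d = real n * b + d + of_int p"
      using Qb by (simp add: algebra_simps)
    have "saw (real (n + Q) * b + d) = saw (real n * b + d)"
      unfolding eq saw_def by (simp only: frac_add_int_right Ints_of_int)
    moreover have "circle (- (real (n + Q) * \<theta>)) = circle (- (real Q * \<theta>)) * circle (- (real n * \<theta>))"
      unfolding circle_add[symmetric] by (rule arg_cong[of _ _ circle]) (simp add: ring_distribs)
    ultimately show "saw (real (n + Q) * b + d) * circle (- (real (n + Q) * \<theta>)) =
        circle (- (real Q * \<theta>)) * (saw (real n * b + d) * circle (- (real n * \<theta>)))"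
      by (simp only: mult_ac)
    show "norm (saw (real n * b + d) * circle (- (real n * \<theta>))) \<le> pi"
      by (simp add: norm_mult norm_saw_le)
  next
    have "of_int q * \<theta> \<notin> \<int>"
      using irrational_multiple_in_Ints[OF \<theta>, of q] q by auto
    then show "circle (- (real Q * \<theta>)) \<noteq> 1"
      using q by (simp add: circle_eq_1_iff minus_in_Ints_iff Q_def)
  qed
qed

definition saw_coeff :: "real \<Rightarrow> real \<Rightarrow> real \<Rightarrow> complex" where
  "saw_coeff \<theta> b d = lim (\<lambda>N. (\<Sum>n<N. saw (real n * b + d) * circle (- (real n * \<theta>))) / of_nat N)"

lemma saw_coeff_eqI:
  "has_mean (\<lambda>n. saw (real n * b + d) * circle (- (real n * \<theta>))) l \<Longrightarrow> saw_coeff \<theta> b d = l"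
  unfolding has_mean_def saw_coeff_def by (rule limI)

text \<open>
  \<open>k b\<close> differs from \<open>\<theta>\<close> by an integer, so it is irrational. This supplies the side conditions
  under which the mean value at a resonance is known.
\<close>
lemma resonance_imp_irrational:
  fixes k :: int
  assumes "\<theta> \<notin> \<rat>" "\<theta> - of_int k * b \<in> \<int>"
  shows "b \<notin> \<rat>" "k \<noteq> 0"
proof -
  have "of_int k * b \<notin> \<rat>"
  proof
    assume "of_int k * b \<in> \<rat>"
    then have "(\<theta> - of_int k * b) + of_int k * b \<in> \<rat>"
      using assms(2) Ints_subset_Rats by (intro Rats_add) auto
    with assms(1) show False by simp
  qed
  then show "b \<notin> \<rat>" "k \<noteq> 0"
    by (auto intro: Rats_mult)
qed

lemma saw_coeff_resonant:
  fixes k :: int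
  assumes "\<theta> \<notin> \<rat>" "\<theta> - of_int k * b \<in> \<int>"
  shows "saw_coeff \<theta> b d = circle (of_int k * d) / of_int k"
  by (rule saw_coeff_eqI[OF has_mean_saw_resonant[OF resonance_imp_irrational[OF assms] assms(2)]])

lemma has_mean_saw_no_resonance:
  assumes "\<theta> \<notin> \<rat>" "\<And>k::int. \<theta> - of_int k * b \<notin> \<int>"
  shows "has_mean (\<lambda>n. saw (real n * b + d) * circle (- (real n * \<theta>))) 0"
proof (cases "b \<in> \<rat>")
  case True
  then show ?thesis by (rule has_mean_saw_rational[OF _ assms(1)])
next
  case False
  then show ?thesis by (rule has_mean_saw_nonresonant[OF _ assms(2)])
qed

lemma saw_coeff_nonresonant:
  assumes "\<theta> \<notin> \<rat>" "\<And>k::int. \<theta> - of_int k * b \<notin> \<int>"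
  shows "saw_coeff \<theta> b d = 0"
  by (intro saw_coeff_eqI has_mean_saw_no_resonance assms)

lemma has_mean_saw_coeff:
  assumes "\<theta> \<notin> \<rat>"
  shows "has_mean (\<lambda>n. saw (real n * b + d) * circle (- (real n * \<theta>))) (saw_coeff \<theta> b d)"
proof (cases "\<exists>k::int. \<theta> - of_int k * b \<in> \<int>")
  case True
  then obtain k :: int where k: "\<theta> - of_int k * b \<in> \<int>" by blast
  show ?thesis
    unfolding saw_coeff_resonant[OF assms k]
    by (rule has_mean_saw_resonant[OF resonance_imp_irrational[OF assms k] k])
next
  case False
  then show ?thesis
    using has_mean_saw_no_resonance saw_coeff_nonresonant assms by metis
qed

section \<open>Matching frequencies\<close>

text \<open>
  Test the equality of the coefficients at the frequencies \<open>q a\<^sub>i\<close> with \<open>q = 1, 2\<close>. By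
  independence only the \<open>i\<close>-th summand on the left resonates. Hence some \<open>b\<^sub>j\<close> resonates with
  \<open>a\<^sub>i\<close>; no \<open>b\<^sub>j\<close> can resonate with two of the \<open>a\<^sub>i\<close>, since these would then be dependent; and
  as both families have the same size, \<open>i \<mapsto> j\<close> is a bijection and only the \<open>j\<close>-th summand on the
  right resonates. Comparing the two surviving coefficients for both values of \<open>q\<close> shows that
  the multiplier is \<open>1\<close> and that the phases agree.
\<close>
lemma saw_coeff_determines:
  fixes a c b d :: "'i::finite \<Rightarrow> real"
  assumes indep: "\<And>u :: 'i \<Rightarrow> int. (\<Sum>i\<in>UNIV. of_int (u i) * a i) \<in> \<int> \<Longrightarrow> u = (\<lambda>i. 0)"
    and eq: "\<And>\<theta>. \<theta> \<notin> \<rat> \<Longrightarrow>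
      (\<Sum>i\<in>UNIV. saw_coeff \<theta> (a i) (c i)) = (\<Sum>i\<in>UNIV. saw_coeff \<theta> (b i) (d i))"
  shows "\<exists>\<tau>. bij \<tau> \<and> (\<forall>i. a i - b (\<tau> i) \<in> \<int> \<and> c i - d (\<tau> i) \<in> \<int>)"
proof -
  have indep2: "u = 0 \<and> v = 0" if "i \<noteq> j" "of_int u * a i - of_int v * a j \<in> \<int>" for i j and u v :: int
  proof -
    define w where "w l = (if l = i then u else 0) + (if l = j then - v else 0)" for l
    have "of_int (w l) * a l = (if l = i then of_int u * a l else 0) - (if l = j then of_int v * a l else 0)" for l
      by (simp add: w_def ring_distribs)
    then have "(\<Sum>l\<in>UNIV. of_int (w l) * a l) = of_int u * a i - of_int v * a j"
      by (simp add: sum_subtractf)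
    with that have "w = (\<lambda>l. 0)"
      by (intro indep) simp
    then have "w i = 0" "w j = 0"
      by auto
    with that show ?thesis
      by (simp add: w_def split: if_splits)
  qed
  have irrational: "of_int q * a i \<notin> \<rat>" if "q \<noteq> 0" for q :: int and i
  proof
    assume "of_int q * a i \<in> \<rat>"
    then obtain s t :: int where st: "t > 0" "of_int q * a i = of_int s / of_int t"
      by (metis Rats_cases')
    define w where "w l = (if l = i then t * q else 0)" for l
    have "of_int (w l) * a l = (if l = i then of_int (t * q) * a l else 0)" for l
      by (simp add: w_def)
    then have "(\<Sum>l\<in>UNIV. of_int (w l) * a l) = of_int t * (of_int q * a i)"
      by simp
    also have "\<dots> = of_int s"
      using st by simp
    finally have "w = (\<lambda>l. 0)"
      by (intro indep) simp
    then have "w i = 0"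
      by simp
    with that st show False
      by (simp add: w_def)
  qed
  have lhs: "(\<Sum>l\<in>UNIV. saw_coeff (of_int q * a i) (a l) (c l)) = circle (of_int q * c i) / of_int q"
    if "q \<noteq> 0" for q :: int and i
  proof -
    have "saw_coeff (of_int q * a i) (a l) (c l) = 0" if "l \<noteq> i" for l
      using indep2[of i l q] that \<open>q \<noteq> 0\<close> by (intro saw_coeff_nonresonant irrational) auto
    moreover have "saw_coeff (of_int q * a i) (a i) (c i) = circle (of_int q * c i) / of_int q"
      using \<open>q \<noteq> 0\<close> by (intro saw_coeff_resonant irrational) auto
    ultimately show ?thesis
      using sum.mono_neutral_right[of UNIV "{i}" "\<lambda>l. saw_coeff (of_int q * a i) (a l) (c l)"] by simp
  qed
  have "\<exists>j k. a i - of_int k * b j \<in> \<int>" for i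
  proof (rule ccontr)
    assume none: "\<nexists>j k. a i - of_int k * b j \<in> \<int>"
    have "saw_coeff (a i) (b j) (d j) = 0" for j
      using none irrational[of 1 i] by (intro saw_coeff_nonresonant) auto
    then have "circle (c i) = 0"
      using eq[of "a i"] lhs[of 1 i] irrational[of 1 i] by simp
    then show False
      by simp
  qed
  then obtain \<tau> \<kappa> where res: "\<And>i. a i - of_int (\<kappa> i) * b (\<tau> i) \<in> \<int>"
    by metis
  have \<kappa>: "\<kappa> i \<noteq> 0" for i
    using resonance_imp_irrational(2)[OF _ res[of i]] irrational[of 1 i] by simp
  \<comment> \<open>Eliminating \<open>b (\<tau> j)\<close> from two resonances with it leaves a relation between two of the \<open>a i\<close>.\<close>
  have combine: "of_int (q * \<kappa> j) * a i - of_int k * a j \<in> \<int>"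
    if "of_int q * a i - of_int k * b (\<tau> j) \<in> \<int>" for i j and q k :: int
  proof -
    have "of_int (\<kappa> j) * (of_int q * a i - of_int k * b (\<tau> j)) - of_int k * (a j - of_int (\<kappa> j) * b (\<tau> j)) \<in> \<int>"
      by (intro Ints_diff Ints_mult that res) auto
    then show ?thesis
      by (simp add: algebra_simps)
  qed
  have "inj \<tau>"
  proof (rule injI, rule ccontr)
    fix i j assume "\<tau> i = \<tau> j" "i \<noteq> j"
    then have "of_int (1 * \<kappa> j) * a i - of_int (\<kappa> i) * a j \<in> \<int>"
      using res[of i] by (intro combine) simp
    with indep2[OF \<open>i \<noteq> j\<close>] \<kappa>[of i] show False
      by blast
  qed
  then have bij: "bij \<tau>"
    by (simp add: bij_def finite_UNIV_inj_surj)
  have rhs: "(\<Sum>l\<in>UNIV. saw_coeff (of_int q * a i) (b l) (d l))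
      = circle (of_int (q * \<kappa> i) * d (\<tau> i)) / of_int (q * \<kappa> i)" if "q \<noteq> 0" for q :: int and i
  proof -
    have "saw_coeff (of_int q * a i) (b l) (d l) = 0" if "l \<noteq> \<tau> i" for l
    proof (intro saw_coeff_nonresonant irrational \<open>q \<noteq> 0\<close> notI)
      fix k :: int assume r: "of_int q * a i - of_int k * b l \<in> \<int>"
      obtain j where "l = \<tau> j"
        using bij by (metis bij_pointE)
      with r that have "j \<noteq> i" "of_int (q * \<kappa> j) * a i - of_int k * a j \<in> \<int>"
        using combine by auto
      with indep2[of i j "q * \<kappa> j" k] \<kappa>[of j] \<open>q \<noteq> 0\<close> show False
        by auto
    qed
    moreover have "saw_coeff (of_int q * a i) (b (\<tau> i)) (d (\<tau> i))
        = circle (of_int (q * \<kappa> i) * d (\<tau> i)) / of_int (q * \<kappa> i)"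
    proof (intro saw_coeff_resonant irrational \<open>q \<noteq> 0\<close>)
      have "of_int q * (a i - of_int (\<kappa> i) * b (\<tau> i)) \<in> \<int>"
        by (intro Ints_mult res) auto
      then show "of_int q * a i - of_int (q * \<kappa> i) * b (\<tau> i) \<in> \<int>"
        by (simp add: algebra_simps)
    qed
    ultimately show ?thesis
      using sum.mono_neutral_right[of UNIV "{\<tau> i}" "\<lambda>l. saw_coeff (of_int q * a i) (b l) (d l)"] by simp
  qed
  have harmonic: "of_int (\<kappa> i) * circle (of_int q * c i) = circle (of_int (q * \<kappa> i) * d (\<tau> i))"
    if "q \<noteq> 0" for q :: int and i
    using lhs[OF that, of i] rhs[OF that, of i] eq[OF irrational[OF that, of i]] that \<kappa>[of i]
    by (simp add: field_simps)
  have "\<kappa> i = 1 \<and> c i - d (\<tau> i) \<in> \<int>" for i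
  proof -
    define u w where "u = circle (c i)" and "w = circle (of_int (\<kappa> i) * d (\<tau> i))"
    have 1: "of_int (\<kappa> i) * u = w"
      using harmonic[of 1 i] by (simp add: u_def w_def)
    have 2: "of_int (\<kappa> i) * u ^ 2 = w ^ 2"
      using harmonic[of 2 i] by (simp add: u_def w_def circle_power mult.assoc)
    \<comment> \<open>With the second harmonic, the multiplier equals its own square.\<close>
    have "of_int (\<kappa> i) * u ^ 2 = of_int (\<kappa> i) ^ 2 * u ^ 2"
      unfolding 2 by (simp add: 1[symmetric] power_mult_distrib)
    then have "of_int (\<kappa> i) = (1 :: complex)"
      using \<kappa>[of i] by (simp add: u_def power2_eq_square)
    then have "\<kappa> i = 1"
      by simp
    with 1 show ?thesis
      by (simp add: u_def w_def circle_eq_iff)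
  qed
  with res have "a i - b (\<tau> i) \<in> \<int>" "c i - d (\<tau> i) \<in> \<int>" for i
    by (metis mult_1 of_int_1)+
  with bij show ?thesis
    by blast
qed

lemma saw_eq_floor: "saw x = 2 * pi * \<i> * of_real (1 / 2 - x + of_int \<lfloor>x\<rfloor>)"
  unfolding saw_def frac_def
  by (rule arg_cong[of _ _ "\<lambda>t. 2 * pi * \<i> * complex_of_real t"]) simp

text \<open>
  The difference of the two sums of sawtooth values is affine in \<open>n\<close>, because the floors cancel.
  It is bounded, so it is constant, and a constant has mean value \<open>0\<close> against a
  character of irrational frequency.
\<close>
lemma saw_coeff_sums_eq:
  fixes a c b d :: "'i::finite \<Rightarrow> real"
  assumes floors: "\<And>n. (\<Sum>i\<in>UNIV. \<lfloor>real n * a i + c i\<rfloor>) = (\<Sum>i\<in>UNIV. \<lfloor>real n * b i + d i\<rfloor>)"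
    and \<theta>: "\<theta> \<notin> \<rat>"
  shows "(\<Sum>i\<in>UNIV. saw_coeff \<theta> (a i) (c i)) = (\<Sum>i\<in>UNIV. saw_coeff \<theta> (b i) (d i))"
proof -
  define F where "F n = (\<Sum>i\<in>UNIV. saw (real n * a i + c i)) - (\<Sum>i\<in>UNIV. saw (real n * b i + d i))" for n
  define A where "A = (\<Sum>i\<in>UNIV. b i) - (\<Sum>i\<in>UNIV. a i)"
  define C where "C = (\<Sum>i\<in>UNIV. d i) - (\<Sum>i\<in>UNIV. c i)"
  have F: "F n = 2 * pi * \<i> * of_real (real n * A + C)" for n
  proof -
    have saw_sum: "(\<Sum>i\<in>UNIV. saw (real n * f i + g i)) = 2 * pi * \<i> *
        of_real (real CARD('i) / 2 - real n * (\<Sum>i\<in>UNIV. f i) - (\<Sum>i\<in>UNIV. g i)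
          + of_int (\<Sum>i\<in>UNIV. \<lfloor>real n * f i + g i\<rfloor>))" for f g :: "'i \<Rightarrow> real"
      unfolding saw_eq_floor sum_distrib_left[symmetric] of_real_sum[symmetric]
      by (simp only: sum.distrib sum_subtractf diff_add_eq_diff_diff_swap)
         (simp add: sum_distrib_left)
    show ?thesis
      unfolding F_def saw_sum floors right_diff_distrib[of "2 * pi * \<i>", symmetric] of_real_diff[symmetric]
      by (rule arg_cong[of _ _ "\<lambda>t. 2 * pi * \<i> * complex_of_real t"])
         (simp add: A_def C_def right_diff_distrib)
  qed
  have "norm (F n) \<le> real CARD('i) * pi + real CARD('i) * pi" for n
    unfolding F_def
    by (intro norm_triangle_le_diff add_mono sum_norm_bound norm_saw_le)
  then have F_bound: "2 * pi * \<bar>real n * A + C\<bar> \<le> real CARD('i) * pi + real CARD('i) * pi" for n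
    unfolding F by (simp only: norm_mult norm_of_real) (simp add: norm_mult)
  have bound: "real n * \<bar>A\<bar> \<le> real CARD('i) + \<bar>C\<bar>" for n
  proof -
    have "pi * \<bar>real n * A + C\<bar> \<le> pi * real CARD('i)"
      using F_bound[of n] by (simp add: mult.commute)
    then have "\<bar>real n * A + C\<bar> \<le> real CARD('i)"
      by simp
    moreover have "real n * \<bar>A\<bar> = \<bar>real n * A\<bar>"
      by (simp add: abs_mult)
    ultimately show ?thesis
      by linarith
  qed
  have "A = 0"
  proof (rule ccontr)
    assume "A \<noteq> 0"
    then obtain n where "real CARD('i) + \<bar>C\<bar> < real n * \<bar>A\<bar>"
      using reals_Archimedean3[of "\<bar>A\<bar>"] by auto
    with bound[of n] show False
      by linarith
  qed
  have "has_mean (\<lambda>n. F n * circle (- (real n * \<theta>)))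
      ((\<Sum>i\<in>UNIV. saw_coeff \<theta> (a i) (c i)) - (\<Sum>i\<in>UNIV. saw_coeff \<theta> (b i) (d i)))"
    unfolding F_def left_diff_distrib sum_distrib_right
    by (intro has_mean_diff has_mean_sum has_mean_saw_coeff \<theta>)
  moreover have "has_mean (\<lambda>n. F n * circle (- (real n * \<theta>))) (2 * pi * \<i> * of_real C * 0)"
  proof -
    have "- \<theta> \<notin> \<int>"
      using \<theta> Ints_subset_Rats minus_in_Ints_iff by blast
    then have "has_mean (\<lambda>n. circle (- (real n * \<theta>))) 0"
      using has_mean_circle[of "- \<theta>"] by simp
    from has_mean_cmult[OF this] show ?thesis
      using \<open>A = 0\<close> unfolding F by simp
  qed
  ultimately have "(\<Sum>i\<in>UNIV. saw_coeff \<theta> (a i) (c i)) - (\<Sum>i\<in>UNIV. saw_coeff \<theta> (b i) (d i)) = 2 * pi * \<i> * of_real C * 0"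
    by (rule has_mean_unique)
  then show ?thesis
    by simp
qed

theorem theorem1:
  fixes \<alpha> \<gamma> \<beta> \<delta> :: "real ^ 'd"
  assumes "\<And>n :: nat. n \<ge> 1 \<Longrightarrow>
    (\<Sum>i\<in>UNIV. \<lfloor>real n * \<alpha> $ i + \<gamma> $ i\<rfloor>) = (\<Sum>i\<in>UNIV. \<lfloor>real n * \<beta> $ i + \<delta> $ i\<rfloor>)"
  shows "rational_vector \<alpha> \<or>
    (\<exists>(\<zeta> :: int ^ 'd) (\<eta> :: int ^ 'd) (\<sigma> :: 'd \<Rightarrow> 'd).
       \<sigma> permutes UNIV \<and>
       (\<forall>i. \<beta> $ i = \<alpha> $ \<sigma> i + real_of_int (\<zeta> $ i) \<and>
            \<delta> $ i = \<gamma> $ \<sigma> i + real_of_int (\<eta> $ i)) \<and>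
       (\<Sum>i\<in>UNIV. \<zeta> $ i) = 0 \<and> (\<Sum>i\<in>UNIV. \<eta> $ i) = 0)"
proof (cases "rational_vector \<alpha>")
  case irrational: False
  have indep: "u = (\<lambda>i. 0)" if "(\<Sum>i\<in>UNIV. of_int (u i) * \<alpha> $ i) \<in> \<int>" for u :: "'d \<Rightarrow> int"
  proof -
    have "(\<chi> i. real_of_int ((\<chi> i. u i) $ i)) \<bullet> \<alpha> \<in> \<int>"
      using that by (simp add: inner_vec_def)
    with irrational have "(\<chi> i. u i) = (0 :: int ^ 'd)"
      unfolding rational_vector_def by blast
    then show ?thesis
      by (simp add: vec_eq_iff fun_eq_iff)
  qed
  \<comment> \<open>Moving one step into the offsets makes the identity hold from \<open>n = 0\<close> on.\<close>
  have floors: "(\<Sum>i\<in>UNIV. \<lfloor>real n * \<alpha> $ i + (\<alpha> $ i + \<gamma> $ i)\<rfloor>)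
      = (\<Sum>i\<in>UNIV. \<lfloor>real n * \<beta> $ i + (\<beta> $ i + \<delta> $ i)\<rfloor>)" for n
    using assms[of "Suc n"] by (simp add: algebra_simps)
  have "\<exists>\<tau>. bij \<tau> \<and> (\<forall>i. \<alpha> $ i - \<beta> $ \<tau> i \<in> \<int> \<and>
      (\<alpha> $ i + \<gamma> $ i) - (\<beta> $ \<tau> i + \<delta> $ \<tau> i) \<in> \<int>)"
    by (rule saw_coeff_determines[OF indep saw_coeff_sums_eq[OF floors]])
  then obtain \<tau> where "bij \<tau>" and \<tau>: "\<And>i. \<alpha> $ i - \<beta> $ \<tau> i \<in> \<int>"
      "\<And>i. (\<alpha> $ i + \<gamma> $ i) - (\<beta> $ \<tau> i + \<delta> $ \<tau> i) \<in> \<int>"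
    by blast
  define \<sigma> where "\<sigma> = inv \<tau>"
  have "bij \<sigma>" and \<tau>\<sigma>: "\<tau> (\<sigma> i) = i" for i
    using \<open>bij \<tau>\<close> by (auto simp: \<sigma>_def bij_imp_bij_inv bij_is_surj surj_f_inv_f)
  then have "\<sigma> permutes UNIV"
    by (intro bij_imp_permutes) auto
  have "\<exists>z e :: int. \<beta> $ i = \<alpha> $ \<sigma> i + of_int z \<and> \<delta> $ i = \<gamma> $ \<sigma> i + of_int e" for i
  proof -
    obtain z y :: int where "\<alpha> $ \<sigma> i - \<beta> $ i = of_int z"
      "(\<alpha> $ \<sigma> i + \<gamma> $ \<sigma> i) - (\<beta> $ i + \<delta> $ i) = of_int y"
      using \<tau>[of "\<sigma> i"] unfolding \<tau>\<sigma> by (auto elim!: Ints_cases)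
    then show ?thesis
      by (intro exI[of _ "- z"] exI[of _ "z - y"]) auto
  qed
  then obtain z e :: "'d \<Rightarrow> int" where ze: "\<And>i. \<beta> $ i = \<alpha> $ \<sigma> i + of_int (z i)"
      "\<And>i. \<delta> $ i = \<gamma> $ \<sigma> i + of_int (e i)"
    by metis
  \<comment> \<open>Substituting the matching into the hypothesis leaves only the integer shifts.\<close>
  have sums: "int n * (\<Sum>i\<in>UNIV. z i) + (\<Sum>i\<in>UNIV. e i) = 0" if "n \<ge> 1" for n
  proof -
    have "\<lfloor>real n * \<beta> $ i + \<delta> $ i\<rfloor> = \<lfloor>real n * \<alpha> $ \<sigma> i + \<gamma> $ \<sigma> i\<rfloor> + (int n * z i + e i)" for i
    proof -
      have "real n * \<beta> $ i + \<delta> $ i = real n * \<alpha> $ \<sigma> i + \<gamma> $ \<sigma> i + of_int (int n * z i + e i)"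
        by (simp add: ze algebra_simps)
      then show ?thesis
        by (simp only: floor_add_int)
    qed
    then have "(\<Sum>i\<in>UNIV. \<lfloor>real n * \<beta> $ i + \<delta> $ i\<rfloor>)
        = (\<Sum>i\<in>UNIV. \<lfloor>real n * \<alpha> $ \<sigma> i + \<gamma> $ \<sigma> i\<rfloor>) + (int n * (\<Sum>i\<in>UNIV. z i) + (\<Sum>i\<in>UNIV. e i))"
      by (simp add: sum.distrib sum_distrib_left)
    also have "(\<Sum>i\<in>UNIV. \<lfloor>real n * \<alpha> $ \<sigma> i + \<gamma> $ \<sigma> i\<rfloor>) = (\<Sum>i\<in>UNIV. \<lfloor>real n * \<alpha> $ i + \<gamma> $ i\<rfloor>)"
      using \<open>bij \<sigma>\<close> by (rule sum.reindex_bij_betw)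
    finally show ?thesis
      using assms[OF that] by simp
  qed
  from sums[of 1] sums[of 2] have "(\<Sum>i\<in>UNIV. z i) = 0" "(\<Sum>i\<in>UNIV. e i) = 0"
    by simp_all
  with ze \<open>\<sigma> permutes UNIV\<close> show ?thesis
    by (intro disjI2 exI[of _ "\<chi> i. z i"] exI[of _ "\<chi> i. e i"] exI[of _ \<sigma>]) simp
qed simp

end
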